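(* Consider hitting costs $f_t(x)=\frac12\|x-v_t\|_2^2$ with switching cost $\frac12\|x_t-x_{t-1}\|_2^2$, where the minimizers $\{v_t\}$ form a martingale in $\mathbb{R}^d$ whose increments all have the same variance $\mathbb{E}\|v_t-v_{t-1}\|_2^2=\sigma^2>0$ (with $v_0=x_0$). For $\underline{x}\in\mathbb{R}^d$ let $\mathrm{Cost}_{\underline{x}}[1,T]$ be the total cost of the static algorithm that plays $x_t=\underline{x}$ in all rounds $t=1,\dots,T$. Then, as $T\to\infty$, $$\mathbb{E}\left[\inf_{\underline{x}\in\mathbb{R}^d}\mathrm{Cost}_{\underline{x}}[1,T]\right]=\Theta(T^2).$$
   Context: The player starts from a given deterministic $x_0\in\mathbb{R}^d$, and the total cost of actions $x_1,\dots,x_T$ is $\mathrm{Cost}[1,T]=\sum_{t=1}^T\left(f_t(x_t)+\frac12\|x_t-x_{t-1}\|_2^2\right)$; thus $\mathrm{Cost}_{\underline{x}}[1,T]=\frac12\|\underline{x}-x_0\|_2^2+\sum_{t=1}^T\frac12\|\underline{x}-v_t\|_2^2$. Martingale means $\mathbb{E}[v_s\mid\mathcal{F}_t]=v_t$ for $s\ge t\ge 1$, where $\mathcal{F}_t=\sigma(v_1,\dots,v_t)$. The infimum is in hindsight, i.e. $\underline{x}$ may depend on the whole realization $v_1,\dots,v_T$. $\Theta(T^2)$: bounded above and below by positive constants (independent of $T$) times $T^2$ for all large $T$. *)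

theory Defs
  imports "HOL-Probability.Probability" "HOL-Library.Landau_Symbols"
begin

text \<open>The action \<open>x 0\<close> is overridden by the given starting point \<open>x0\<close>.\<close>

definition total_cost ::
    "(nat \<Rightarrow> real ^ 'd \<Rightarrow> real) \<Rightarrow> real ^ 'd \<Rightarrow> (nat \<Rightarrow> real ^ 'd) \<Rightarrow> nat \<Rightarrow> real" where
  "total_cost f x0 x T =
     (\<Sum>t=1..T. f t (x t) + (1/2) * (norm (x t - (x(0 := x0)) (t - 1)))\<^sup>2)"

definition static_cost ::
    "(nat \<Rightarrow> real ^ 'd \<Rightarrow> real) \<Rightarrow> real ^ 'd \<Rightarrow> nat \<Rightarrow> real ^ 'd \<Rightarrow> real" where
  "static_cost f x0 T y = total_cost f x0 (\<lambda>t. y) T"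

definition quadratic_hitting_cost :: "(nat \<Rightarrow> real ^ 'd) \<Rightarrow> nat \<Rightarrow> real ^ 'd \<Rightarrow> real" where
  "quadratic_hitting_cost v t x = (1/2) * (norm (x - v t))\<^sup>2"

lemma static_cost_quadratic:
  assumes "T \<ge> 1"
  shows "static_cost (quadratic_hitting_cost v) x0 T y =
           (1/2) * (norm (y - x0))\<^sup>2 + (\<Sum>t=1..T. (1/2) * (norm (y - v t))\<^sup>2)"
  using assms
proof (induction T rule: dec_induct)
  case base
  show ?case
    by (simp add: static_cost_def total_cost_def quadratic_hitting_cost_def)
next
  case (step n)
  then show ?case
    by (simp add: static_cost_def total_cost_def quadratic_hitting_cost_def)
qed

text \<open>The filtration \<open>\<sigma>(v\<^sub>1, \<dots>, v\<^sub>t)\<close>; the index \<open>0\<close> is excluded.\<close>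

definition natural_filtration ::
    "'a measure \<Rightarrow> (nat \<Rightarrow> 'a \<Rightarrow> real ^ 'd) \<Rightarrow> nat \<Rightarrow> 'a measure" where
  "natural_filtration M v t =
     sigma (space M) {v s -` B \<inter> space M | s B. s \<in> {1..t} \<and> B \<in> sets borel}"

text \<open>The library provides conditional expectations of real-valued functions only; for vectors
  the conditional expectation is taken in each coordinate.\<close>

definition vec_cond_exp ::
    "'a measure \<Rightarrow> 'a measure \<Rightarrow> ('a \<Rightarrow> real ^ 'd) \<Rightarrow> 'a \<Rightarrow> real ^ 'd" where
  "vec_cond_exp M F X = (\<lambda>\<omega>. \<chi> i. real_cond_exp M F (\<lambda>\<omega>'. X \<omega>' $ i) \<omega>)"

text \<open>Nothing is required of \<open>v 0\<close>; in particular the mean of \<open>v 1\<close> is not prescribed.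
  Measurability of the \<open>v t\<close> is part of integrability.\<close>

definition martingale :: "'a measure \<Rightarrow> (nat \<Rightarrow> 'a \<Rightarrow> real ^ 'd) \<Rightarrow> bool" where
  "martingale M v \<longleftrightarrow>
     (\<forall>t\<ge>1. integrable M (v t)) \<and>
     (\<forall>t\<ge>1. \<forall>s\<ge>t. AE \<omega> in M. vec_cond_exp M (natural_filtration M v t) (v s) \<omega> = v t \<omega>)"

end

theory Submission
  imports Defs
begin

text \<open>Put \<open>w\<^sub>t = v\<^sub>t - x\<^sub>0\<close> and \<open>s\<^sub>T = w\<^sub>1 + \<dots> + w\<^sub>T\<close>. Completing the square, the static optimum
  is the mean of the \<open>T + 1\<close> points \<open>x\<^sub>0, v\<^sub>1, \<dots>, v\<^sub>T\<close>, and its cost is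
  \<open>1/2 (\<Sum>|w\<^sub>t|\<^sup>2 - |s\<^sub>T|\<^sup>2 / (T + 1))\<close>. Martingale increments are orthogonal to the past, so
  \<open>E |w\<^sub>t|\<^sup>2 = t \<sigma>\<^sup>2\<close>, \<open>E \<langle>s\<^sub>T, w\<^sub>T\<rangle> = \<sigma>\<^sup>2 T (T + 1) / 2\<close> and
  \<open>E |s\<^sub>T|\<^sup>2 = \<sigma>\<^sup>2 T (T + 1) (2 T + 1) / 6\<close>. The expected optimal static cost is therefore
  exactly \<open>\<sigma>\<^sup>2 T (T + 2) / 12\<close>. The mean of \<open>v\<^sub>1\<close> plays no role, because orthogonality is only
  used for the increments after time 1.\<close>

subsection \<open>The optimal static action\<close>

text \<open>Completing the square, with the factor \<open>c\<close> kept outside so that the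
  constant term carries a single division. It is applied with \<open>c\<close> equal to
  \<open>T + 1\<close>.\<close>

lemma scaled_norm_diff_square:
  fixes a b :: "'a::real_inner" and c :: real
  assumes "c \<noteq> 0"
  shows "c * (norm (a - b /\<^sub>R c))\<^sup>2 = c * (norm a)\<^sup>2 - 2 * (a \<bullet> b) + (norm b)\<^sup>2 / c"
  using assms
  by (simp add: power2_norm_eq_inner inner_simps inner_commute[of b a] field_simps)

text \<open>With the origin moved to \<open>x0\<close>, the initial switching cost acts as one more
  point to be approximated, so the quadratic in \<open>y - x0\<close> has leading coefficient
  \<open>(T + 1) / 2\<close>. The first summand is free of \<open>y\<close>, and the second is a
  nonnegative multiple of a square.\<close>

lemma static_cost_complete_square:
  fixes v :: "nat \<Rightarrow> real ^ 'd" and x0 y :: "real ^ 'd"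
  assumes "T \<ge> 1"
  defines "S \<equiv> \<Sum>t=1..T. v t - x0"
  shows "static_cost (quadratic_hitting_cost v) x0 T y =
     (1/2) * ((\<Sum>t=1..T. (norm (v t - x0))\<^sup>2) - (norm S)\<^sup>2 / (real T + 1))
     + (real T + 1) / 2 * (norm (y - x0 - S /\<^sub>R (real T + 1)))\<^sup>2"
proof -
  have expand: "(norm (y - v t))\<^sup>2 =
      (norm (y - x0))\<^sup>2 - 2 * ((y - x0) \<bullet> (v t - x0)) + (norm (v t - x0))\<^sup>2" for t
    by (simp add: power2_norm_eq_inner inner_simps inner_commute algebra_simps)
  have "static_cost (quadratic_hitting_cost v) x0 T y =
      (1/2) * ((norm (y - x0))\<^sup>2 + (\<Sum>t=1..T. (norm (y - v t))\<^sup>2))"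
    by (simp add: static_cost_quadratic[OF assms(1)] sum_distrib_left algebra_simps)
  also have "(\<Sum>t=1..T. (norm (y - v t))\<^sup>2) =
      real T * (norm (y - x0))\<^sup>2 - 2 * ((y - x0) \<bullet> S) + (\<Sum>t=1..T. (norm (v t - x0))\<^sup>2)"
  proof -
    have "(\<Sum>t=1..T. 2 * ((y - x0) \<bullet> (v t - x0))) = 2 * ((y - x0) \<bullet> S)"
      unfolding S_def inner_sum_right sum_distrib_left ..
    then show ?thesis
      unfolding expand sum.distrib sum_subtractf by simp
  qed
  finally have cost: "static_cost (quadratic_hitting_cost v) x0 T y =
      (1/2) * ((real T + 1) * (norm (y - x0))\<^sup>2 - 2 * ((y - x0) \<bullet> S)
        + (\<Sum>t=1..T. (norm (v t - x0))\<^sup>2))"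
    by (simp add: algebra_simps)
  have square: "(real T + 1) * (norm (y - x0 - S /\<^sub>R (real T + 1)))\<^sup>2 =
      (real T + 1) * (norm (y - x0))\<^sup>2 - 2 * ((y - x0) \<bullet> S) + (norm S)\<^sup>2 / (real T + 1)"
    by (rule scaled_norm_diff_square) linarith
  have "(real T + 1) / 2 * (norm (y - x0 - S /\<^sub>R (real T + 1)))\<^sup>2 =
      (1/2) * ((real T + 1) * (norm (y - x0 - S /\<^sub>R (real T + 1)))\<^sup>2)"
    by simp
  then show ?thesis
    unfolding cost square by (simp only: right_diff_distrib distrib_left)
qed

lemma INF_static_cost:
  fixes v :: "nat \<Rightarrow> real ^ 'd" and x0 :: "real ^ 'd"
  assumes "T \<ge> 1"
  shows "(INF y. static_cost (quadratic_hitting_cost v) x0 T y) =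
     (1/2) * ((\<Sum>t=1..T. (norm (v t - x0))\<^sup>2) - (norm (\<Sum>t=1..T. v t - x0))\<^sup>2 / (real T + 1))"
    (is "_ = ?m")
proof (rule cInf_eq_non_empty)
  \<comment> \<open>This action annihilates the square, so the lower bound \<open>?m\<close> is
    attained.\<close>
  let ?y = "x0 + (\<Sum>t=1..T. v t - x0) /\<^sub>R (real T + 1)"
  show "?m \<le> c" if c: "c \<in> range (static_cost (quadratic_hitting_cost v) x0 T)" for c
  proof -
    obtain y where "c = static_cost (quadratic_hitting_cost v) x0 T y"
      using c by blast
    then show ?thesis
      unfolding static_cost_complete_square[OF assms] by (metis add_increasing2 order_refl
          divide_nonneg_nonneg mult_nonneg_nonneg of_nat_0_le_iff add_nonneg_nonneg zero_le_one
          zero_le_numeral zero_le_power2)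
  qed
  show "z \<le> ?m"
    if "\<And>c. c \<in> range (static_cost (quadratic_hitting_cost v) x0 T) \<Longrightarrow> z \<le> c" for z
    using that[OF rangeI, of ?y] unfolding static_cost_complete_square[OF assms] by simp
qed simp

subsection \<open>Square-integrable random vectors\<close>

lemma borel_measurable_vec_nth:
  fixes X :: "'a \<Rightarrow> real ^ 'd"
  shows "X \<in> borel_measurable M \<Longrightarrow> (\<lambda>\<omega>. X \<omega> $ i) \<in> borel_measurable M"
  by (rule borel_measurable_continuous_on[OF linear_continuous_on[OF bounded_linear_vec_nth]])

text \<open>Measurability of \<open>X\<close> is demanded separately because integrability of its
  squared norm only makes that norm measurable. The general codomain covers both vectors and their
  coordinates.\<close>

definition square_integrable :: "'a measure \<Rightarrow> ('a \<Rightarrow> 'b::euclidean_space) \<Rightarrow> bool" where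
  "square_integrable M X \<longleftrightarrow> X \<in> borel_measurable M \<and> integrable M (\<lambda>\<omega>. (norm (X \<omega>))\<^sup>2)"

text \<open>The inner product is dominated by the sum of the squared norms, through
  Cauchy-Schwarz.\<close>

lemma square_integrable_inner:
  assumes "square_integrable M X" "square_integrable M Y"
  shows "integrable M (\<lambda>\<omega>. X \<omega> \<bullet> Y \<omega>)"
proof (rule Bochner_Integration.integrable_bound)
  show "integrable M (\<lambda>\<omega>. (norm (X \<omega>))\<^sup>2 + (norm (Y \<omega>))\<^sup>2)"
    using assms by (simp add: square_integrable_def)
  show "(\<lambda>\<omega>. X \<omega> \<bullet> Y \<omega>) \<in> borel_measurable M"
    using assms unfolding square_integrable_def by auto
  have "norm (x \<bullet> y) \<le> norm ((norm x)\<^sup>2 + (norm y)\<^sup>2)" for x y :: 'b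
  proof -
    have "\<bar>x \<bullet> y\<bar> \<le> norm x * norm y" by (rule Cauchy_Schwarz_ineq2)
    also have "\<dots> \<le> (norm x)\<^sup>2 + (norm y)\<^sup>2"
    proof -
      \<comment> \<open>The elementary inequality bounds twice the product; nonnegativity allows one
        copy to be dropped.\<close>
      have "0 \<le> norm x * norm y" by simp
      then show ?thesis using sum_squares_bound[of "norm x" "norm y"] by linarith
    qed
    finally show ?thesis by simp
  qed
  then show "AE \<omega> in M. norm (X \<omega> \<bullet> Y \<omega>) \<le> norm ((norm (X \<omega>))\<^sup>2 + (norm (Y \<omega>))\<^sup>2)"
    by simp
qed

lemma square_integrable_add:
  assumes X: "square_integrable M X" and Y: "square_integrable M Y"
  shows "square_integrable M (\<lambda>\<omega>. X \<omega> + Y \<omega>)"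
proof -
  have "integrable M (\<lambda>\<omega>. (norm (X \<omega>))\<^sup>2 + 2 * (X \<omega> \<bullet> Y \<omega>) + (norm (Y \<omega>))\<^sup>2)"
    using assms square_integrable_inner[OF X Y] by (simp add: square_integrable_def)
  then have "integrable M (\<lambda>\<omega>. (norm (X \<omega> + Y \<omega>))\<^sup>2)"
    by (simp add: power2_norm_eq_inner inner_simps inner_commute algebra_simps)
  then show ?thesis
    using assms by (auto simp: square_integrable_def intro!: borel_measurable_add)
qed

lemma square_integrable_sum:
  assumes "\<And>i. i \<in> I \<Longrightarrow> square_integrable M (X i)"
  shows "square_integrable M (\<lambda>\<omega>. \<Sum>i\<in>I. X i \<omega>)"
  using assms
proof (induction I rule: infinite_finite_induct)
  case (insert i I)
  then show ?case by (auto intro!: square_integrable_add)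
qed (simp_all add: square_integrable_def)

lemma square_integrable_nth:
  fixes X :: "'a \<Rightarrow> real ^ 'd"
  assumes "square_integrable M X"
  shows "square_integrable M (\<lambda>\<omega>. X \<omega> $ i)"
proof -
  have meas: "(\<lambda>\<omega>. X \<omega> $ i) \<in> borel_measurable M"
    using assms unfolding square_integrable_def by (auto intro: borel_measurable_vec_nth)
  moreover have "integrable M (\<lambda>\<omega>. (norm (X \<omega> $ i))\<^sup>2)"
  proof (rule Bochner_Integration.integrable_bound)
    show "integrable M (\<lambda>\<omega>. (norm (X \<omega>))\<^sup>2)"
      using assms by (simp add: square_integrable_def)
    show "AE \<omega> in M. norm ((norm (X \<omega> $ i))\<^sup>2) \<le> norm ((norm (X \<omega>))\<^sup>2)"
      by (intro AE_I2) (simp add: abs_le_square_iff[symmetric] component_le_norm_cart)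
  qed (use meas in measurable)
  ultimately show ?thesis by (simp add: square_integrable_def)
qed

subsection \<open>Orthogonality of martingale increments\<close>

lemma sets_natural_filtration:
  "sets (natural_filtration M v t) =
     sigma_sets (space M) {v s -` B \<inter> space M | s B. s \<in> {1..t} \<and> B \<in> sets borel}"
  unfolding natural_filtration_def by (rule sets_measure_of) auto

lemma space_natural_filtration [simp]: "space (natural_filtration M v t) = space M"
  unfolding natural_filtration_def by (rule space_measure_of) auto

lemma measurable_natural_filtration:
  "1 \<le> s \<Longrightarrow> s \<le> t \<Longrightarrow> v s \<in> borel_measurable (natural_filtration M v t)"
  by (rule measurableI) (auto simp: sets_natural_filtration intro!: sigma_sets.Basic)

lemma subalgebra_natural_filtration:
  assumes "\<And>s. 1 \<le> s \<Longrightarrow> s \<le> t \<Longrightarrow> v s \<in> borel_measurable M"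
  shows "subalgebra M (natural_filtration M v t)"
  unfolding subalgebra_def
proof
  show "sets (natural_filtration M v t) \<subseteq> sets M"
    unfolding sets_natural_filtration
    by (rule sets.sigma_sets_subset) (auto intro!: measurable_sets[OF assms])
qed simp

text \<open>Given the past up to time \<open>t\<close>, the factor \<open>Z\<close> is known and
  \<open>v s\<close> averages to \<open>v t\<close>; hence \<open>v s - v t\<close> is orthogonal to
  \<open>Z\<close>. Conditional expectations are coordinatewise, so this is shown for each
  coordinate product and then summed.\<close>

lemma martingale_integral_inner:
  fixes v :: "nat \<Rightarrow> 'a \<Rightarrow> real ^ 'd"
  assumes "prob_space M" and mart: "martingale M v" and t: "1 \<le> t" "t \<le> s"
    and Z: "Z \<in> borel_measurable (natural_filtration M v t)" "square_integrable M Z"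
    and v: "square_integrable M (v t)" "square_integrable M (v s)"
  shows "(\<integral>\<omega>. Z \<omega> \<bullet> v s \<omega> \<partial>M) = (\<integral>\<omega>. Z \<omega> \<bullet> v t \<omega> \<partial>M)"
proof -
  interpret prob_space M by fact
  let ?F = "natural_filtration M v t"
  have "v r \<in> borel_measurable M" if "1 \<le> r" for r
    using mart that by (auto simp: martingale_def)
  then have sub: "subalgebra M ?F"
    by (rule subalgebra_natural_filtration)
  interpret finite_measure_subalgebra M ?F
    by unfold_locales (rule sub)
  have int: "integrable M (\<lambda>\<omega>. Z \<omega> $ i * v r \<omega> $ i)" if "square_integrable M (v r)" for r i
    using square_integrable_inner[OF square_integrable_nth[OF Z(2)] square_integrable_nth[OF that]]
    by simp
  have Zi: "(\<lambda>\<omega>. Z \<omega> $ i) \<in> borel_measurable ?F" for i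
    using Z(1) by (rule borel_measurable_vec_nth)
  have coord: "(\<integral>\<omega>. Z \<omega> $ i * v s \<omega> $ i \<partial>M) = (\<integral>\<omega>. Z \<omega> $ i * v t \<omega> $ i \<partial>M)" for i
  proof -
    have vs: "(\<lambda>\<omega>. v s \<omega> $ i) \<in> borel_measurable M"
      using square_integrable_nth[OF v(2), of i] by (simp add: square_integrable_def)
    have "AE \<omega> in M. vec_cond_exp M ?F (v s) \<omega> = v t \<omega>"
      using mart t by (auto simp: martingale_def)
    then have ae: "AE \<omega> in M. Z \<omega> $ i * real_cond_exp M ?F (\<lambda>\<omega>'. v s \<omega>' $ i) \<omega> = Z \<omega> $ i * v t \<omega> $ i"
      by eventually_elim (simp add: vec_cond_exp_def vec_eq_iff)
    \<comment> \<open>The factor measurable at time \<open>t\<close> is pulled out of the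
      conditional expectation; this asks for integrability of the product, supplied by
      \<open>int\<close>.\<close>
    have "(\<integral>\<omega>. Z \<omega> $ i * v s \<omega> $ i \<partial>M) =
        (\<integral>\<omega>. Z \<omega> $ i * real_cond_exp M ?F (\<lambda>\<omega>'. v s \<omega>' $ i) \<omega> \<partial>M)"
      using real_cond_exp_intg(2)[OF int[OF v(2)] Zi vs] by simp
    also have "\<dots> = (\<integral>\<omega>. Z \<omega> $ i * v t \<omega> $ i \<partial>M)"
      by (rule integral_cong_AE[OF _ _ ae])
        (use int[OF v(1)] measurable_from_subalg[OF sub Zi] in
          \<open>auto intro!: borel_measurable_times borel_measurable_cond_exp2\<close>)
    finally show ?thesis .
  qed
  show ?thesis
    by (simp add: inner_vec_def coord int v)
qed

subsection \<open>The expected cost of the optimal static action\<close>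

text \<open>Three recursions in time, each feeding the next: first the second moment of
  \<open>w t\<close>, then the mixed moment of \<open>S t\<close> and \<open>w t\<close>, then the
  second moment of \<open>S t\<close>. In each, orthogonality replaces \<open>w (Suc t)\<close> by
  \<open>w t\<close> in the cross term.\<close>

lemma martingale_static_moments:
  fixes v :: "nat \<Rightarrow> 'a \<Rightarrow> real ^ 'd" and x0 :: "real ^ 'd"
  assumes M: "prob_space M" and mart: "martingale M v"
    and v0: "\<And>\<omega>. \<omega> \<in> space M \<Longrightarrow> v 0 \<omega> = x0"
    and pos: "\<sigma>\<^sup>2 > 0"
    and var: "\<And>t. t \<ge> 1 \<Longrightarrow> (\<integral>\<omega>. (norm (v t \<omega> - v (t - 1) \<omega>))\<^sup>2 \<partial>M) = \<sigma>\<^sup>2"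
    and T: "T \<ge> 1"
  defines "w \<equiv> \<lambda>t \<omega>. v t \<omega> - x0"
  defines "S \<equiv> \<lambda>T \<omega>. \<Sum>t=1..T. w t \<omega>"
  shows "square_integrable M (w T)"
    and "(\<integral>\<omega>. (norm (w T \<omega>))\<^sup>2 \<partial>M) = real T * \<sigma>\<^sup>2"
    and "square_integrable M (S T)"
    and "(\<integral>\<omega>. (norm (S T \<omega>))\<^sup>2 \<partial>M) = real T * (real T + 1) * (2 * real T + 1) / 6 * \<sigma>\<^sup>2"
proof -
  interpret prob_space M by fact
  have meas: "v t \<in> borel_measurable M" if "1 \<le> t" for t
    using mart that by (auto simp: martingale_def)
  have const: "square_integrable M (\<lambda>\<omega>. c :: real ^ 'd)" for c
    by (simp add: square_integrable_def)
  \<comment> \<open>a nonzero Bochner integral forces integrability\<close>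
  have incr: "integrable M (\<lambda>\<omega>. (norm (v t \<omega> - v (t - 1) \<omega>))\<^sup>2)" if "1 \<le> t" for t
    using var[OF that] pos not_integrable_integral_eq by force
  have D: "square_integrable M (\<lambda>\<omega>. v (Suc t) \<omega> - v t \<omega>)" if "1 \<le> t" for t
    using incr[of "Suc t"] meas[of t] meas[of "Suc t"] that by (simp add: square_integrable_def)
  \<comment> \<open>The first increment is treated apart: \<open>v 0\<close> is known to equal
    \<open>x0\<close> on \<open>space M\<close> only, so integrals are compared by congruence
    there.\<close>
  have w1_eq: "(norm (v 1 \<omega> - v (1 - 1) \<omega>))\<^sup>2 = (norm (w 1 \<omega>))\<^sup>2" if "\<omega> \<in> space M" for \<omega>
    using v0[OF that] by (simp add: w_def)
  have w1: "square_integrable M (w 1)"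
    using iffD1[OF Bochner_Integration.integrable_cong[OF refl w1_eq] incr[of 1]] meas[of 1]
    by (simp add: square_integrable_def w_def)
  have w1_var: "(\<integral>\<omega>. (norm (w 1 \<omega>))\<^sup>2 \<partial>M) = \<sigma>\<^sup>2"
    unfolding var[of 1, OF order_refl, symmetric]
    by (rule Bochner_Integration.integral_cong[OF refl w1_eq[symmetric]])
  have w_Suc: "w (Suc t) \<omega> = w t \<omega> + (v (Suc t) \<omega> - v t \<omega>)" for t \<omega>
    by (simp add: w_def)
  have w: "square_integrable M (w t)" if "1 \<le> t" for t
    using that
  proof (induction t rule: nat_induct_at_least)
    case (Suc t)
    then show ?case
      using square_integrable_add[OF Suc.IH D[OF Suc.hyps]] by (simp add: w_def)
  qed (rule w1)
  have S: "square_integrable M (S t)" for t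
    unfolding S_def by (rule square_integrable_sum) (auto intro: w)
  have v: "square_integrable M (v t)" if "1 \<le> t" for t
    using square_integrable_add[OF w[OF that] const[of x0]] by (simp add: w_def)
  \<comment> \<open>Shifting by \<open>x0\<close> changes both integrals by the same amount, so the
    orthogonality for \<open>v\<close> carries over to \<open>w\<close>.\<close>
  have cross: "(\<integral>\<omega>. Z \<omega> \<bullet> w (Suc t) \<omega> \<partial>M) = (\<integral>\<omega>. Z \<omega> \<bullet> w t \<omega> \<partial>M)"
    if "1 \<le> t" "Z \<in> borel_measurable (natural_filtration M v t)" "square_integrable M Z" for t Z
    using martingale_integral_inner[OF M mart that(1) _ that(2,3) v v, of "Suc t"] that(1)
    by (simp add: w_def inner_diff_right square_integrable_inner[OF that(3)] v const)
  have w_F: "w s \<in> borel_measurable (natural_filtration M v t)" if "1 \<le> s" "s \<le> t" for s t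
    unfolding w_def using measurable_natural_filtration[OF that, of v M] by simp
  have S_F: "S t \<in> borel_measurable (natural_filtration M v t)" for t
    unfolding S_def by (auto intro!: borel_measurable_sum w_F)
  have var_w: "(\<integral>\<omega>. (norm (w t \<omega>))\<^sup>2 \<partial>M) = real t * \<sigma>\<^sup>2" if "1 \<le> t" for t
    using that
  proof (induction t rule: nat_induct_at_least)
    case base
    then show ?case using w1_var by simp
  next
    case (Suc t)
    have ww: "integrable M (\<lambda>\<omega>. w t \<omega> \<bullet> w (Suc t) \<omega>)" "integrable M (\<lambda>\<omega>. w t \<omega> \<bullet> w t \<omega>)"
      by (rule square_integrable_inner; use Suc.hyps w in simp)+
    \<comment> \<open>The expansion of the squared increment is solved for \<open>w (Suc t)\<close>.
      The cross term then has the shape of \<open>cross\<close> with \<open>Z\<close> taken as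
      \<open>w t\<close>, and its integral becomes the second moment of \<open>w t\<close>.\<close>
    have "(norm (w (Suc t) \<omega>))\<^sup>2 = (norm (v (Suc t) \<omega> - v (Suc t - 1) \<omega>))\<^sup>2
        + 2 * (w t \<omega> \<bullet> w (Suc t) \<omega>) - w t \<omega> \<bullet> w t \<omega>" for \<omega>
      unfolding w_Suc by (simp add: power2_norm_eq_inner inner_add_left inner_add_right inner_commute)
    then have "(\<integral>\<omega>. (norm (w (Suc t) \<omega>))\<^sup>2 \<partial>M) =
        \<sigma>\<^sup>2 + 2 * (\<integral>\<omega>. w t \<omega> \<bullet> w (Suc t) \<omega> \<partial>M) - (\<integral>\<omega>. w t \<omega> \<bullet> w t \<omega> \<partial>M)"
      using ww incr[of "Suc t"] var[of "Suc t"] by simp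
    also have "\<dots> = \<sigma>\<^sup>2 + (\<integral>\<omega>. (norm (w t \<omega>))\<^sup>2 \<partial>M)"
      using cross[OF Suc.hyps w_F w] Suc.hyps by (simp add: power2_norm_eq_inner)
    finally show ?case
      using Suc.IH by (simp add: algebra_simps)
  qed
  have S_Suc: "S (Suc t) \<omega> = S t \<omega> + w (Suc t) \<omega>" for t \<omega>
    by (simp add: S_def)
  have S_w: "(\<integral>\<omega>. S t \<omega> \<bullet> w t \<omega> \<partial>M) = real t * (real t + 1) / 2 * \<sigma>\<^sup>2" if "1 \<le> t" for t
    using that
  proof (induction t rule: nat_induct_at_least)
    case base
    then show ?case using w1_var by (simp add: S_def power2_norm_eq_inner)
  next
    case (Suc t)
    have "(\<integral>\<omega>. S (Suc t) \<omega> \<bullet> w (Suc t) \<omega> \<partial>M) =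
        (\<integral>\<omega>. S t \<omega> \<bullet> w (Suc t) \<omega> \<partial>M) + (\<integral>\<omega>. (norm (w (Suc t) \<omega>))\<^sup>2 \<partial>M)"
      using S[of t] w[of "Suc t"]
      by (simp add: S_Suc inner_add_left power2_norm_eq_inner square_integrable_inner)
    also have "\<dots> = real t * (real t + 1) / 2 * \<sigma>\<^sup>2 + real (Suc t) * \<sigma>\<^sup>2"
      using cross[OF Suc.hyps S_F S] Suc.IH var_w[of "Suc t"] by simp
    finally show ?case by (simp add: field_simps)
  qed
  have var_S: "(\<integral>\<omega>. (norm (S t \<omega>))\<^sup>2 \<partial>M) = real t * (real t + 1) * (2 * real t + 1) / 6 * \<sigma>\<^sup>2"
    if "1 \<le> t" for t
    using that
  proof (induction t rule: nat_induct_at_least)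
    case base
    then show ?case using w1_var by (simp add: S_def)
  next
    case (Suc t)
    have "(norm (S (Suc t) \<omega>))\<^sup>2 = (norm (S t \<omega>))\<^sup>2 + 2 * (S t \<omega> \<bullet> w (Suc t) \<omega>) + (norm (w (Suc t) \<omega>))\<^sup>2" for \<omega>
      unfolding S_Suc by (simp add: power2_norm_eq_inner inner_add_left inner_add_right inner_commute)
    then have "(\<integral>\<omega>. (norm (S (Suc t) \<omega>))\<^sup>2 \<partial>M) =
        (\<integral>\<omega>. (norm (S t \<omega>))\<^sup>2 \<partial>M) + 2 * (\<integral>\<omega>. S t \<omega> \<bullet> w (Suc t) \<omega> \<partial>M) + (\<integral>\<omega>. (norm (w (Suc t) \<omega>))\<^sup>2 \<partial>M)"
      using S[of t] w[of "Suc t"] square_integrable_inner[OF S[of t] w[of "Suc t"]]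
      by (simp add: square_integrable_def)
    \<comment> \<open>The last two terms add up to
      \<open>(t + 1)\<^sup>2 * \<sigma>\<^sup>2\<close>, so the closed form is that of the sum of
      the first squares.\<close>
    also have "\<dots> = real t * (real t + 1) * (2 * real t + 1) / 6 * \<sigma>\<^sup>2
        + real t * (real t + 1) * \<sigma>\<^sup>2 + real (Suc t) * \<sigma>\<^sup>2"
      using cross[OF Suc.hyps S_F S] Suc.IH S_w[OF Suc.hyps] var_w[of "Suc t"] by simp
    finally show ?case by (simp add: field_simps)
  qed
  show "square_integrable M (w T)" "(\<integral>\<omega>. (norm (w T \<omega>))\<^sup>2 \<partial>M) = real T * \<sigma>\<^sup>2"
    "square_integrable M (S T)"
    "(\<integral>\<omega>. (norm (S T \<omega>))\<^sup>2 \<partial>M) = real T * (real T + 1) * (2 * real T + 1) / 6 * \<sigma>\<^sup>2"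
    using w var_w S var_S T by auto
qed

text \<open>By linearity the two moments suffice. In units of \<open>\<sigma>\<^sup>2\<close> they
  contribute \<open>T * (T + 1) / 2\<close> and, after division by \<open>T + 1\<close>,
  \<open>T * (2 * T + 1) / 6\<close>. The leading terms \<open>T\<^sup>2 / 2\<close> and
  \<open>T\<^sup>2 / 3\<close> do not cancel, which makes the growth quadratic.\<close>

lemma expected_INF_static_cost:
  fixes v :: "nat \<Rightarrow> 'a \<Rightarrow> real ^ 'd" and x0 :: "real ^ 'd"
  assumes M: "prob_space M" and mart: "martingale M v"
    and v0: "\<And>\<omega>. \<omega> \<in> space M \<Longrightarrow> v 0 \<omega> = x0"
    and pos: "\<sigma>\<^sup>2 > 0"
    and var: "\<And>t. t \<ge> 1 \<Longrightarrow> (\<integral>\<omega>. (norm (v t \<omega> - v (t - 1) \<omega>))\<^sup>2 \<partial>M) = \<sigma>\<^sup>2"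
    and T: "T \<ge> 1"
  shows "(\<integral>\<omega>. (INF y. static_cost (quadratic_hitting_cost (\<lambda>t. v t \<omega>)) x0 T y) \<partial>M) =
    \<sigma>\<^sup>2 / 12 * (real T * (real T + 2))"
proof -
  note moments = martingale_static_moments[OF M mart v0 pos var]
  have int_w: "integrable M (\<lambda>\<omega>. (norm (v t \<omega> - x0))\<^sup>2)" if "t \<in> {1..T}" for t
    using moments(1)[of t] that by (simp add: square_integrable_def)
  have int_S: "integrable M (\<lambda>\<omega>. (norm (\<Sum>t=1..T. v t \<omega> - x0))\<^sup>2)"
    using moments(3)[OF _ _ T] by (simp add: square_integrable_def)
  have sum_w: "(\<Sum>t=1..T. \<integral>\<omega>. (norm (v t \<omega> - x0))\<^sup>2 \<partial>M) = real T * (real T + 1) / 2 * \<sigma>\<^sup>2"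
  proof -
    have "(\<Sum>t=1..T. \<integral>\<omega>. (norm (v t \<omega> - x0))\<^sup>2 \<partial>M) = (\<Sum>t=1..T. real t) * \<sigma>\<^sup>2"
      unfolding sum_distrib_right by (rule sum.cong) (use moments(2) in auto)
    also have "(\<Sum>t=1..T. real t) = real T * (real T + 1) / 2"
      by (induction T) (auto simp: field_simps)
    finally show ?thesis .
  qed
  have "(\<integral>\<omega>. (INF y. static_cost (quadratic_hitting_cost (\<lambda>t. v t \<omega>)) x0 T y) \<partial>M) =
      (1/2) * ((\<Sum>t=1..T. \<integral>\<omega>. (norm (v t \<omega> - x0))\<^sup>2 \<partial>M)
        - (\<integral>\<omega>. (norm (\<Sum>t=1..T. v t \<omega> - x0))\<^sup>2 \<partial>M) / (real T + 1))"
    unfolding INF_static_cost[OF T] using int_w int_S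
    by (subst integral_mult_right_zero, subst Bochner_Integration.integral_diff) auto
  also have "\<dots> = (1/2) * (real T * (real T + 1) / 2 * \<sigma>\<^sup>2
      - real T * (real T + 1) * (2 * real T + 1) / 6 * \<sigma>\<^sup>2 / (real T + 1))"
    unfolding sum_w by (subst moments(4)[OF _ _ T]) simp_all
  also have "real T * (real T + 1) * (2 * real T + 1) / 6 * \<sigma>\<^sup>2 / (real T + 1) =
      real T * (2 * real T + 1) / 6 * \<sigma>\<^sup>2"
    using of_nat_0_le_iff[of T, where 'a=real] by (simp add: divide_simps)
  finally show ?thesis
    by (simp add: field_simps)
qed

theorem theorem3p4:
  fixes M :: "'a measure"
    and v :: "nat \<Rightarrow> 'a \<Rightarrow> real ^ 'd"
    and x0 :: "real ^ 'd"
    and \<sigma> :: real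
  assumes "prob_space M"
    and "martingale M v"
    and "\<And>\<omega>. \<omega> \<in> space M \<Longrightarrow> v 0 \<omega> = x0"
    and "\<sigma>\<^sup>2 > 0"
    and "\<And>t. t \<ge> 1 \<Longrightarrow> (\<integral>\<omega>. (norm (v t \<omega> - v (t - 1) \<omega>))\<^sup>2 \<partial>M) = \<sigma>\<^sup>2"
  shows "(\<lambda>T::nat. \<integral>\<omega>. (INF y. static_cost (quadratic_hitting_cost (\<lambda>t. v t \<omega>)) x0 T y) \<partial>M)
           \<in> \<Theta>(\<lambda>T. (real T)\<^sup>2)"
proof -
  define E where
    "E = (\<lambda>T. \<integral>\<omega>. (INF y. static_cost (quadratic_hitting_cost (\<lambda>t. v t \<omega>)) x0 T y) \<partial>M)"
  have "E \<in> \<Theta>(\<lambda>T. (real T)\<^sup>2)"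
  proof (rule bigthetaI')
    \<comment> \<open>The lower constant comes from \<open>T + 2 \<ge> T\<close>, the upper one from
      \<open>T + 2 \<le> 3 * T\<close> for \<open>T \<ge> 1\<close>, which triples it.\<close>
    show "\<sigma>\<^sup>2 / 12 > 0" "\<sigma>\<^sup>2 / 4 > 0"
      using assms(4) by simp_all
    show "\<forall>\<^sub>F T in sequentially. \<sigma>\<^sup>2 / 12 * norm ((real T)\<^sup>2) \<le> norm (E T) \<and>
        norm (E T) \<le> \<sigma>\<^sup>2 / 4 * norm ((real T)\<^sup>2)"
      using eventually_ge_at_top[of 1]
    proof eventually_elim
      case (elim T)
      have "E T = \<sigma>\<^sup>2 / 12 * (real T * (real T + 2))"
        unfolding E_def by (rule expected_INF_static_cost[OF assms elim])
      then have "norm (E T) = \<sigma>\<^sup>2 / 12 * (real T * (real T + 2))"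
        by (simp only: real_norm_def abs_of_nonneg) simp
      moreover have "(real T)\<^sup>2 \<le> real T * (real T + 2)" "real T * (real T + 2) \<le> 3 * (real T)\<^sup>2"
        using elim by (simp_all add: power2_eq_square algebra_simps)
      ultimately show ?case
        using mult_left_mono[of "(real T)\<^sup>2" "real T * (real T + 2)" "\<sigma>\<^sup>2 / 12"]
          mult_left_mono[of "real T * (real T + 2)" "3 * (real T)\<^sup>2" "\<sigma>\<^sup>2 / 12"]
        by (simp add: algebra_simps)
    qed
  qed
  then show ?thesis
    unfolding E_def .
qed

end
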